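(* Let $K\subset\mathbb{R}^2$ be the Sierpiński gasket with intrinsic metric $d^K$, and let $G_n$ ($n=0,1,2,\dots$) be its network approximations with geodesic metrics $d^G_n$ (as defined in the context). Then for all $a,b\in K$ and arbitrary sequences $a_n\in G_n$, $b_n\in G_n$ with $d^K(a_n,a)\to0$ and $d^K(b_n,b)\to0$, one has $$d^G_n(a_n,b_n)\to d^K(a,b)\quad\text{as } n\to\infty.$$
   Context: Let $O_1=(-\tfrac12,0)$, $O_2=(\tfrac12,0)$, $O_3=(0,\tfrac{\sqrt3}{2})$ in $\mathbb{R}^2$ and $F_i(y)=\tfrac12(y-O_i)+O_i$ for $i=1,2,3$. The Sierpiński gasket $K$ is the unique nonempty compact set with $K=F_1(K)\cup F_2(K)\cup F_3(K)$. The network approximation is $G_0=$ the boundary of the triangle with vertices $O_1,O_2,O_3$ (the union of its three sides) and $G_{n+1}=F_1(G_n)\cup F_2(G_n)\cup F_3(G_n)$; one has $G_n\subset K$. The metrics $d^K$ and $d^G_n$ are the intrinsic metrics on $K$ and $G_n$: the infimum of Euclidean lengths of curves joining two points inside the set. *)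

theory Defs
  imports "HOL-Analysis.Analysis"
begin

definition O1 :: "real^2" where "O1 = vector [- (1/2), 0]"
definition O2 :: "real^2" where "O2 = vector [1/2, 0]"
definition O3 :: "real^2" where "O3 = vector [0, sqrt 3 / 2]"

definition half_contraction :: "real^2 \<Rightarrow> real^2 \<Rightarrow> real^2" where
  "half_contraction c y = (1/2) *\<^sub>R (y - c) + c"

definition gasket_step :: "(real^2) set \<Rightarrow> (real^2) set" where
  "gasket_step S = half_contraction O1 ` S \<union> half_contraction O2 ` S \<union> half_contraction O3 ` S"

definition sierpinski_gasket :: "(real^2) set" where
  "sierpinski_gasket = (THE K. K \<noteq> {} \<and> compact K \<and> K = gasket_step K)"

primrec gasket_network :: "nat \<Rightarrow> (real^2) set" where
  "gasket_network 0 = closed_segment O1 O2 \<union> closed_segment O2 O3 \<union> closed_segment O3 O1"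
| "gasket_network (Suc n) = gasket_step (gasket_network n)"

text \<open>Length of a curve parametrised by \<open>[0,1]\<close>: the supremum of the lengths of inscribed
  polygons, with value \<open>\<infinity>\<close> for non-rectifiable curves.\<close>

definition curve_length :: "(real \<Rightarrow> 'a::metric_space) \<Rightarrow> ennreal" where
  "curve_length g =
     (SUP (n, t) \<in> {(n, t :: nat \<Rightarrow> real). t 0 = 0 \<and> t n = 1 \<and> (\<forall>i<n. t i \<le> t (Suc i))}.
        ennreal (\<Sum>i<n. dist (g (t i)) (g (t (Suc i)))))"

text \<open>The infimum is taken in \<^typ>\<open>ennreal\<close>, so the distance is \<open>\<infinity>\<close> (and not an unspecified
  real number) if no rectifiable curve inside \<open>S\<close> joins the points.\<close>

definition intrinsic_dist :: "'a::metric_space set \<Rightarrow> 'a \<Rightarrow> 'a \<Rightarrow> ennreal" where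
  "intrinsic_dist S x y =
     (INF g \<in> {g. path g \<and> path_image g \<subseteq> S \<and> pathstart g = x \<and> pathfinish g = y}. curve_length g)"

text \<open>The definite description in \<open>sierpinski_gasket\<close> is well defined.\<close>

lemma dist_half_contraction:
  "dist (half_contraction c x) (half_contraction c y) = dist x y / 2"
proof -
  have "half_contraction c x - half_contraction c y = (1/2) *\<^sub>R (x - y)"
    by (simp add: half_contraction_def algebra_simps)
  then show ?thesis by (simp add: dist_norm)
qed

lemma inj_half_contraction: "inj (half_contraction c)"
  by (auto simp: inj_def half_contraction_def)

lemma gasket_step_mono: "S \<subseteq> T \<Longrightarrow> gasket_step S \<subseteq> gasket_step T"
  unfolding gasket_step_def by blast

lemma compact_gasket_step: "compact S \<Longrightarrow> compact (gasket_step S)"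
  unfolding gasket_step_def half_contraction_def
  by (intro compact_Un compact_continuous_image continuous_intros)

lemma gasket_step_fixed_subset:
  assumes A: "compact A" "A = gasket_step A"
    and B: "compact B" "B \<noteq> {}" "B = gasket_step B"
  shows "A \<subseteq> B"
proof
  fix x assume x: "x \<in> A"
  obtain b0 where b0: "b0 \<in> B" using B by auto
  obtain D where D: "\<And>y. y \<in> A \<Longrightarrow> dist y b0 \<le> D"
    using compact_imp_bounded[OF A(1)] bounded_any_center[of A b0]
    by (auto simp: dist_commute)
  have approx: "y \<in> A \<Longrightarrow> \<exists>b\<in>B. dist y b \<le> D / 2 ^ n" for y n
  proof (induction n arbitrary: y)
    case 0
    then show ?case using D b0 by auto
  next
    case (Suc n)
    from Suc.prems A(2) obtain c z where c: "c \<in> {O1, O2, O3}" "z \<in> A" "y = half_contraction c z"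
      unfolding gasket_step_def by blast
    obtain b where b: "b \<in> B" "dist z b \<le> D / 2 ^ n" using Suc.IH c(2) by blast
    have "half_contraction c b \<in> B"
      using b(1) c(1) B(3) unfolding gasket_step_def by blast
    moreover have "dist y (half_contraction c b) \<le> D / 2 ^ Suc n"
      using b(2) by (simp add: c(3) dist_half_contraction)
    ultimately show ?case by blast
  qed
  have "(\<lambda>n. D / 2 ^ n) \<longlonglongrightarrow> 0"
    using LIMSEQ_divide_realpow_zero[of 2 D] by simp
  then have "\<exists>b\<in>B. dist b x < e" if "e > 0" for e
  proof -
    from \<open>(\<lambda>n. D / 2 ^ n) \<longlonglongrightarrow> 0\<close> that obtain n where "D / 2 ^ n < e"
      by (metis eventually_sequentially order_refl order_tendstoD(2))
    then show ?thesis using approx[OF x, of n] by (force simp: dist_commute)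
  qed
  then have "x \<in> closure B" by (simp add: closure_approachable)
  then show "x \<in> B" using compact_imp_closed[OF B(1)] by simp
qed

lemma gasket_step_fixed_exists: "\<exists>K. K \<noteq> {} \<and> compact K \<and> K = gasket_step K"
proof -
  define R where "R = Max {norm O1, norm O2, norm O3}"
  define A where "A n = (gasket_step ^^ n) (cball 0 R)" for n
  have R: "norm O1 \<le> R" "norm O2 \<le> R" "norm O3 \<le> R" by (auto simp: R_def)
  have ball: "half_contraction c y \<in> cball 0 R" if "norm c \<le> R" "norm y \<le> R" for c y
  proof -
    have "half_contraction c y = (1/2) *\<^sub>R y + (1/2) *\<^sub>R c"
      by (simp add: half_contraction_def vec_eq_iff algebra_simps)
    then have "norm (half_contraction c y) \<le> norm y / 2 + norm c / 2"
      using norm_triangle_ineq[of "(1/2) *\<^sub>R y" "(1/2) *\<^sub>R c"] by simp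
    then show ?thesis using that by simp
  qed
  have A_Suc: "A (Suc n) = gasket_step (A n)" for n by (simp add: A_def)
  have A1: "A (Suc 0) \<subseteq> A 0"
    unfolding A_Suc by (auto simp: A_def gasket_step_def intro!: ball R simp del: mem_cball)
  have dec1: "A (Suc n) \<subseteq> A n" for n
    by (induction n) (use A1 in \<open>simp, metis A_Suc gasket_step_mono\<close>)
  have dec: "m \<le> n \<Longrightarrow> A n \<subseteq> A m" for m n
    using lift_Suc_antimono_le[of A m n] dec1 by blast
  have comp: "compact (A n)" for n
    by (induction n) (auto simp: A_Suc compact_gasket_step, simp add: A_def)
  have "norm O1 \<ge> 0" by simp
  then have "R \<ge> 0" using R(1) by linarith
  then have ne: "A n \<noteq> {}" for n
    by (induction n) (auto simp: A_Suc gasket_step_def, simp add: A_def)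
  define K where "K = (\<Inter>n. A n)"
  have "K \<noteq> {}"
    unfolding K_def by (rule compact_nest) (use comp ne dec in auto)
  moreover have "compact K"
    unfolding K_def by (intro compact_Inter) (use comp in auto)
  moreover have "gasket_step K \<subseteq> K"
  proof -
    have "gasket_step K \<subseteq> A n" for n
      using gasket_step_mono[of K "A n"] A_Suc[of n] dec1[of n] by (auto simp: K_def)
    then show ?thesis by (auto simp: K_def)
  qed
  moreover have "K \<subseteq> gasket_step K"
  proof
    fix x assume x: "x \<in> K"
    have "\<exists>c\<in>{O1, O2, O3}. \<forall>n. x \<in> half_contraction c ` A n"
    proof (rule ccontr)
      assume "\<not> ?thesis"
      then obtain n1 n2 n3 where n: "x \<notin> half_contraction O1 ` A n1"
        "x \<notin> half_contraction O2 ` A n2" "x \<notin> half_contraction O3 ` A n3" by auto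
      let ?n = "max n1 (max n2 n3)"
      have "A ?n \<subseteq> A n1" "A ?n \<subseteq> A n2" "A ?n \<subseteq> A n3" by (auto intro!: dec)
      then have "x \<notin> gasket_step (A ?n)" using n unfolding gasket_step_def by blast
      then show False using x A_Suc[of ?n] by (auto simp: K_def simp del: max.bounded_iff)
    qed
    then obtain c where c: "c \<in> {O1, O2, O3}" "\<And>n. x \<in> half_contraction c ` A n" by blast
    then obtain y where y: "x = half_contraction c y" by blast
    have "y \<in> A n" for n
      using c(2)[of n] inj_half_contraction[of c] unfolding y by (auto dest: injD)
    then have "y \<in> K" by (auto simp: K_def)
    then show "x \<in> gasket_step K" using c(1) y unfolding gasket_step_def by blast
  qed
  ultimately show ?thesis by blast
qed

lemma sierpinski_gasket_unique_existence: "\<exists>!K. K \<noteq> {} \<and> compact K \<and> K = gasket_step K"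
proof (rule ex_ex1I[OF gasket_step_fixed_exists])
  fix K L assume "K \<noteq> {} \<and> compact K \<and> K = gasket_step K" "L \<noteq> {} \<and> compact L \<and> L = gasket_step L"
  then show "K = L"
    using gasket_step_fixed_subset[of K L] gasket_step_fixed_subset[of L K] by blast
qed

end

(* Since the network lies in the gasket, only an upper bound for the network distance is at issue,
   and it suffices to show that on the n-th network it exceeds the gasket distance by at most
   O(2^-n). Given a point p of the network, let f(y) be the minimum of d_n(p, v) + |y - v| over the
   vertices v of the level-n cells containing y. As the vertices of a cell are joined by straight
   segments of the network and distinct cells meet only in common vertices, f is 1-Lipschitz for the
   Euclidean distance on each cell and agrees with d_n(p, .) at vertices. A curve in the gasket can
   be cut into finitely many pieces, each with both endpoints in one cell, so f grows along it by
   at most its length. Taking f with values in [0, \<infinity>] makes it unnecessary to know beforehand that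
   distances are finite. *)

theory Submission
  imports Defs
begin

section \<open>Curve length and intrinsic distance\<close>

text \<open>Lets bounds involving an intrinsic distance be checked one curve at a time. Moving
  \<open>c\<close> to the other side by subtraction requires it to be finite; for infinite
  \<open>c\<close> the bound is trivial.\<close>

lemma le_INF_add_ennreal:
  fixes c z :: ennreal
  assumes "\<And>i. i \<in> I \<Longrightarrow> z \<le> g i + c"
  shows "z \<le> (INF i\<in>I. g i) + c"
proof (cases "c = top")
  case False
  have "z - c \<le> (INF i\<in>I. g i)"
    using assms False by (intro INF_greatest) (simp add: ennreal_minus_le_iff add.commute)
  then show ?thesis using False by (simp add: ennreal_minus_le_iff add.commute)
qed simp

lemma sum_le_curve_length:
  assumes "t 0 = 0" "t n = 1" "\<And>i. i < n \<Longrightarrow> t i \<le> t (Suc i)"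
  shows "ennreal (\<Sum>i<n. dist (g (t i)) (g (t (Suc i)))) \<le> curve_length g"
  unfolding curve_length_def
  by (rule SUP_upper2[where i="(n, t)"]) (use assms in auto)

lemma curve_length_le:
  assumes "\<And>n t. \<lbrakk>t 0 = 0; t n = 1; \<And>i. i < n \<Longrightarrow> t i \<le> t (Suc i); \<And>i. i \<le> n \<Longrightarrow> t i \<in> {0..1}\<rbrakk>
    \<Longrightarrow> ennreal (\<Sum>i<n. dist (g (t i)) (g (t (Suc i)))) \<le> B"
  shows "curve_length g \<le> B"
  unfolding curve_length_def
proof (rule SUP_least, clarify)
  fix n and t :: "nat \<Rightarrow> real"
  assume t: "t 0 = 0" "t n = 1" "\<forall>i<n. t i \<le> t (Suc i)"
  have mono: "t i \<le> t j" if "i \<le> j" "j \<le> n" for i j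
    using that by (induction j) (use t(3) in \<open>auto simp: le_Suc_eq intro: order_trans\<close>)
  show "ennreal (\<Sum>i<n. dist (g (t i)) (g (t (Suc i)))) \<le> B"
    using mono[of 0] mono[of _ n] t by (intro assms) auto
qed

lemma curve_length_join:
  assumes "pathfinish g = pathstart h"
  shows "curve_length (g +++ h) \<le> curve_length g + curve_length h"
proof (rule curve_length_le)
  fix n and t :: "nat \<Rightarrow> real"
  assume t: "t 0 = 0" "t n = 1" "\<And>i. i < n \<Longrightarrow> t i \<le> t (Suc i)" "\<And>i. i \<le> n \<Longrightarrow> t i \<in> {0..1}"
  \<comment> \<open>The partition of each half is padded with constant parameters, so no point need be inserted at 1/2.\<close>
  define r s where "r i = min (2 * t i) 1" and "s i = max (2 * t i - 1) 0" for i
  have gh: "g 1 = h 0" using assms by (simp add: pathfinish_def pathstart_def)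
  have "dist ((g +++ h) (t i)) ((g +++ h) (t (Suc i)))
      \<le> dist (g (r i)) (g (r (Suc i))) + dist (h (s i)) (h (s (Suc i)))" if "i < n" for i
  proof -
    consider "t (Suc i) \<le> 1/2" | "t i \<le> 1/2" "t (Suc i) > 1/2" | "t i > 1/2" by linarith
    then show ?thesis
    proof cases
      case 1
      then show ?thesis using t(3)[OF that] by (simp add: joinpaths_def r_def)
    next
      case 2
      \<comment> \<open>Here \<open>r (Suc i)\<close> is 1 and \<open>s i\<close> is 0, so the
        interval straddling 1/2 contributes to both sums, through the junction
        \<open>g 1\<close>.\<close>
      then show ?thesis using dist_triangle[of "g (2 * t i)" "h (2 * t (Suc i) - 1)" "g 1"] gh
        by (simp add: joinpaths_def r_def s_def min_absorb1 min_absorb2 max_absorb1 max_absorb2)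
    next
      case 3
      then show ?thesis using t(3)[OF that] by (simp add: joinpaths_def s_def)
    qed
  qed
  then have "(\<Sum>i<n. dist ((g +++ h) (t i)) ((g +++ h) (t (Suc i))))
      \<le> (\<Sum>i<n. dist (g (r i)) (g (r (Suc i)))) + (\<Sum>i<n. dist (h (s i)) (h (s (Suc i))))"
    by (auto simp flip: sum.distrib intro: sum_mono)
  then have "ennreal (\<Sum>i<n. dist ((g +++ h) (t i)) ((g +++ h) (t (Suc i))))
      \<le> ennreal (\<Sum>i<n. dist (g (r i)) (g (r (Suc i)))) + ennreal (\<Sum>i<n. dist (h (s i)) (h (s (Suc i))))"
    by (subst ennreal_plus[symmetric]) (auto intro: sum_nonneg ennreal_leI)
  also have "\<dots> \<le> curve_length g + curve_length h"
  proof (intro add_mono sum_le_curve_length)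
    show "r 0 = 0" "r n = 1" "s 0 = 0" "s n = 1" using t by (auto simp: r_def s_def)
    show "r i \<le> r (Suc i)" "s i \<le> s (Suc i)" if "i < n" for i
      using t(3)[OF that] by (auto simp: r_def s_def)
  qed
  finally show "ennreal (\<Sum>i<n. dist ((g +++ h) (t i)) ((g +++ h) (t (Suc i))))
      \<le> curve_length g + curve_length h" .
qed

lemma curve_length_reversepath: "curve_length (reversepath g) \<le> curve_length g"
proof (rule curve_length_le)
  fix n and t :: "nat \<Rightarrow> real"
  assume t: "t 0 = 0" "t n = 1" "\<And>i. i < n \<Longrightarrow> t i \<le> t (Suc i)"
  define s where "s i = 1 - t (n - i)" for i
  have "(\<Sum>i<n. dist (reversepath g (t i)) (reversepath g (t (Suc i))))
      = (\<Sum>i<n. dist (reversepath g (t (n - Suc i))) (reversepath g (t (Suc (n - Suc i)))))"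
    by (rule sum.nat_diff_reindex[symmetric])
  also have "\<dots> = (\<Sum>i<n. dist (g (s i)) (g (s (Suc i))))"
    by (rule sum.cong) (auto simp: s_def reversepath_def Suc_diff_Suc dist_commute)
  also have "ennreal \<dots> \<le> curve_length g"
  proof (rule sum_le_curve_length)
    show "s i \<le> s (Suc i)" if "i < n" for i
      using t(3)[of "n - Suc i"] that by (simp add: s_def Suc_diff_Suc)
  qed (use t in \<open>auto simp: s_def\<close>)
  finally show "ennreal (\<Sum>i<n. dist (reversepath g (t i)) (reversepath g (t (Suc i))))
      \<le> curve_length g" .
qed

lemma curve_length_linepath:
  fixes a b :: "'a::real_normed_vector"
  shows "curve_length (linepath a b) \<le> ennreal (dist a b)"
proof (rule curve_length_le)
  fix n and t :: "nat \<Rightarrow> real"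
  assume t: "t 0 = 0" "t n = 1" "\<And>i. i < n \<Longrightarrow> t i \<le> t (Suc i)"
  have "dist (linepath a b x) (linepath a b y) = (y - x) * dist a b" if "x \<le> y" for x y
  proof -
    have "linepath a b x - linepath a b y = (y - x) *\<^sub>R (a - b)"
      by (simp add: linepath_def algebra_simps)
    then show ?thesis using that by (simp add: dist_norm)
  qed
  then have "(\<Sum>i<n. dist (linepath a b (t i)) (linepath a b (t (Suc i))))
      = (\<Sum>i<n. (t (Suc i) - t i) * dist a b)"
    using t(3) by (intro sum.cong) auto
  also have "\<dots> = dist a b"
    using t by (simp flip: sum_distrib_right add: sum_lessThan_telescope)
  finally show "ennreal (\<Sum>i<n. dist (linepath a b (t i)) (linepath a b (t (Suc i))))
      \<le> ennreal (dist a b)" by simp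
qed

lemma intrinsic_dist_le:
  assumes "path g" "path_image g \<subseteq> S" "pathstart g = x" "pathfinish g = y"
  shows "intrinsic_dist S x y \<le> curve_length g"
  unfolding intrinsic_dist_def by (rule INF_lower) (use assms in auto)

lemma intrinsic_dist_mono: "S \<subseteq> T \<Longrightarrow> intrinsic_dist T x y \<le> intrinsic_dist S x y"
  unfolding intrinsic_dist_def by (rule INF_superset_mono) auto

lemma intrinsic_dist_triangle:
  "intrinsic_dist S x z \<le> intrinsic_dist S x y + intrinsic_dist S y z"
proof -
  have "intrinsic_dist S x z \<le> curve_length g + curve_length h"
    if "path g" "path_image g \<subseteq> S" "pathstart g = x" "pathfinish g = y"
      "path h" "path_image h \<subseteq> S" "pathstart h = y" "pathfinish h = z" for g h
    using that by (intro order_trans[OF intrinsic_dist_le[of "g +++ h"] curve_length_join])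
      (auto simp: path_image_join)
  then have "intrinsic_dist S x z \<le> curve_length h + intrinsic_dist S x y"
    if "path h" "path_image h \<subseteq> S" "pathstart h = y" "pathfinish h = z" for h
    unfolding intrinsic_dist_def[of S x y] add.commute[of "curve_length h"] using that
    by (intro le_INF_add_ennreal) auto
  then show ?thesis
    unfolding intrinsic_dist_def[of S y z] add.commute[of "intrinsic_dist S x y"]
    by (intro le_INF_add_ennreal) auto
qed

lemma intrinsic_dist_commute: "intrinsic_dist S x y = intrinsic_dist S y x"
proof -
  have "intrinsic_dist S x y \<le> intrinsic_dist S y x" for x y
    unfolding intrinsic_dist_def[of S y x]
    by (intro INF_greatest order_trans[OF intrinsic_dist_le curve_length_reversepath]) auto
  then show ?thesis by (metis antisym)
qed

lemma intrinsic_dist_closed_segment: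
  fixes x y :: "'a::real_normed_vector"
  assumes "closed_segment x y \<subseteq> S"
  shows "intrinsic_dist S x y \<le> ennreal (dist x y)"
  using assms by (intro order_trans[OF intrinsic_dist_le curve_length_linepath]) auto

section \<open>Growth of a piecewise Lipschitz function along a curve\<close>

text \<open>Each time, leave a piece \<open>A\<close> at the last parameter where the curve visits it; the rest of the
  curve is covered by the remaining pieces.\<close>

lemma path_subdivision_closed_cover:
  fixes g :: "real \<Rightarrow> 'a::topological_space"
  assumes "finite \<A>" "\<And>A. A \<in> \<A> \<Longrightarrow> closed A" "s \<in> {0..1}"
    and "continuous_on {0..1} g" "g ` {s..1} \<subseteq> \<Union>\<A>"
  shows "\<exists>n t. t 0 = s \<and> t n = 1 \<and> (\<forall>i<n. t i \<le> t (Suc i) \<and> (\<exists>A\<in>\<A>. g (t i) \<in> A \<and> g (t (Suc i)) \<in> A))"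
  using assms
proof (induction \<A> arbitrary: s rule: finite_psubset_induct)
  case (psubset \<A>)
  have "s \<in> {s..1}" using psubset.prems(2) by auto
  then have "g s \<in> \<Union>\<A>" using psubset.prems(4) by blast
  then obtain A where A: "A \<in> \<A>" "g s \<in> A" by blast
  have contg: "continuous_on {u..1} g" if "u \<ge> 0" for u
    by (rule continuous_on_subset[OF psubset.prems(3)]) (use that in auto)
  have cl: "closed ({u..1} \<inter> g -` B)" if "closed B" "u \<ge> 0" for B u
    using that by (intro continuous_closed_preimage contg) auto
  let ?R = "{s..1} \<inter> g -` A"
  have "compact ?R"
    using compact_Int_closed[OF compact_Icc cl[OF psubset.prems(1)[OF A(1)], of s], of s 1] psubset.prems(2)
    by (simp add: Int_assoc[symmetric])
  moreover have "s \<in> ?R" using A psubset.prems(2) by auto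
  ultimately obtain u where u: "u \<in> ?R" "\<And>r. r \<in> ?R \<Longrightarrow> r \<le> u"
    using compact_attains_sup[of ?R] by blast
  have u01: "u \<in> {0..1}" "s \<le> u" "g u \<in> A" using u(1) psubset.prems(2) by auto
  show ?case
  proof (cases "u = 1")
    case True
    show ?thesis
      \<comment> \<open>A single interval from \<open>s\<close> to 1 suffices, since both of its
        ends are mapped into \<open>A\<close>.\<close>
      by (rule exI[of _ 1], rule exI[of _ "case_nat s (\<lambda>_. 1)"]) (use True u01 A in auto)
  next
    case False
    let ?B = "\<Union>(\<A> - {A})"
    have "closed ?B" using psubset.hyps psubset.prems(1) by (intro closed_Union) auto
    have "{u<..1} \<subseteq> {u..1} \<inter> g -` ?B"
    proof
      fix r assume r: "r \<in> {u<..1}"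
      then have "r \<in> {s..1}" using u01 by auto
      then have "g r \<in> \<Union>\<A>" using psubset.prems(4) by blast
      moreover have "g r \<notin> A" using \<open>r \<in> {s..1}\<close> u(2)[of r] r by auto
      ultimately show "r \<in> {u..1} \<inter> g -` ?B" using r by auto
    qed
    \<comment> \<open>The parameter \<open>u\<close> itself must also be mapped into the remaining
      pieces for the induction hypothesis to apply. It is a limit of later parameters, and the union
      of the remaining pieces is closed.\<close>
    then have "closure {u<..1} \<subseteq> {u..1} \<inter> g -` ?B"
      by (rule closure_minimal) (use cl[OF \<open>closed ?B\<close>] u01 in auto)
    then have "{u..1} \<subseteq> g -` ?B" using False u01 by simp
    then have B: "g ` {u..1} \<subseteq> ?B" by blast
    have "\<A> - {A} \<subset> \<A>" using A by auto
    then have "\<exists>n t. t 0 = u \<and> t n = 1 \<and>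
        (\<forall>i<n. t i \<le> t (Suc i) \<and> (\<exists>A\<in>\<A> - {A}. g (t i) \<in> A \<and> g (t (Suc i)) \<in> A))"
      by (rule psubset.IH[OF _ _ u01(1) psubset.prems(3) B]) (simp add: psubset.prems(1))
    then obtain n t where t: "t 0 = u \<and> t n = 1 \<and>
        (\<forall>i<n. t i \<le> t (Suc i) \<and> (\<exists>A\<in>\<A> - {A}. g (t i) \<in> A \<and> g (t (Suc i)) \<in> A))"
      by (elim exE)
    show ?thesis
    proof (rule exI[of _ "Suc n"], rule exI[of _ "case_nat s t"], intro conjI allI impI)
      fix i assume i: "i < Suc n"
      show "case_nat s t i \<le> case_nat s t (Suc i)"
        using t i u01(2) by (cases i) simp_all
      show "\<exists>X\<in>\<A>. g (case_nat s t i) \<in> X \<and> g (case_nat s t (Suc i)) \<in> X"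
      proof (cases i)
        case 0
        then show ?thesis using t A u01(3) by auto
      next
        case (Suc j)
        then have "\<exists>X\<in>\<A> - {A}. g (t j) \<in> X \<and> g (t (Suc j)) \<in> X" using t i by simp
        then show ?thesis using Suc by auto
      qed
    qed (use t in simp_all)
  qed
qed

text \<open>The Lipschitz bounds add up along a partition whose consecutive points share a piece,
  and the resulting sum of distances is one of those whose supremum is the length. The pieces will
  be the level-n cells.\<close>

lemma lipschitz_on_pieces_le_curve_length:
  fixes f :: "'a::metric_space \<Rightarrow> ennreal"
  assumes "finite \<A>" "\<And>A. A \<in> \<A> \<Longrightarrow> closed A"
    and g: "path g" "path_image g \<subseteq> \<Union>\<A>"
    and f: "\<And>A x y. \<lbrakk>A \<in> \<A>; x \<in> A; y \<in> A\<rbrakk> \<Longrightarrow> f y \<le> f x + ennreal (dist x y)"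
  shows "f (pathfinish g) \<le> f (pathstart g) + curve_length g"
proof -
  obtain n t where t: "t 0 = 0" "t n = 1"
    "\<And>i. i < n \<Longrightarrow> t i \<le> t (Suc i) \<and> (\<exists>A\<in>\<A>. g (t i) \<in> A \<and> g (t (Suc i)) \<in> A)"
    using path_subdivision_closed_cover[OF assms(1,2) _ g[unfolded path_def path_image_def]] by auto
  have "f (g (t k)) \<le> f (g 0) + ennreal (\<Sum>i<k. dist (g (t i)) (g (t (Suc i))))" if "k \<le> n" for k
    using that
  proof (induction k)
    case (Suc k)
    have "f (g (t (Suc k))) \<le> f (g (t k)) + ennreal (dist (g (t k)) (g (t (Suc k))))"
      using t(3)[of k] Suc.prems f by (meson Suc_le_eq)
    also have "\<dots> \<le> f (g 0) + ennreal (\<Sum>i<k. dist (g (t i)) (g (t (Suc i))))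
        + ennreal (dist (g (t k)) (g (t (Suc k))))"
      using Suc by (intro add_right_mono) auto
    finally show ?case by (simp add: add.assoc sum_nonneg ennreal_plus)
  qed (simp add: t)
  from this[of n] have "f (g 1) \<le> f (g 0) + ennreal (\<Sum>i<n. dist (g (t i)) (g (t (Suc i))))"
    using t by simp
  also have "\<dots> \<le> f (g 0) + curve_length g"
    using t by (intro add_left_mono sum_le_curve_length) auto
  finally show ?thesis by (simp add: pathstart_def pathfinish_def)
qed

section \<open>Cells of the gasket\<close>

definition gasket_vertices :: "(real^2) set" where
  "gasket_vertices = {O1, O2, O3}"

text \<open>\<open>barycentric c\<close> is the affine function with value 1 at the vertex \<open>c\<close> and 0 at the other two.\<close>

definition barycentric :: "real^2 \<Rightarrow> real^2 \<Rightarrow> real" where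
  "barycentric c y =
     (if c = O1 then 1/2 - y$1 - y$2 / sqrt 3
      else if c = O2 then 1/2 + y$1 - y$2 / sqrt 3
      else 2 * y$2 / sqrt 3)"

text \<open>The filled triangle with corners \<open>O1\<close>, \<open>O2\<close>,
  \<open>O3\<close>. It contains the gasket, and being cut out by linear inequalities it makes
  intersections of cells easy to compute.\<close>

definition gasket_triangle :: "(real^2) set" where
  "gasket_triangle = {y. \<forall>c\<in>gasket_vertices. 0 \<le> barycentric c y}"

text \<open>The compositions of n contractions. The new letter is outermost, so induction peels off
  the coarsest subdivision and all smaller cells are compared inside the same big triangle.\<close>

primrec cell_maps :: "nat \<Rightarrow> (real^2 \<Rightarrow> real^2) set" where
  "cell_maps 0 = {id}"
| "cell_maps (Suc n) = (\<Union>c\<in>gasket_vertices. (\<lambda>\<phi>. half_contraction c \<circ> \<phi>) ` cell_maps n)"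

lemma gasket_step_eq: "gasket_step S = (\<Union>c\<in>gasket_vertices. half_contraction c ` S)"
  by (auto simp: gasket_step_def gasket_vertices_def)

lemma vertex_coords:
  "O1$1 = -1/2" "O1$2 = 0" "O2$1 = 1/2" "O2$2 = 0" "O3$1 = 0" "O3$2 = sqrt 3 / 2"
  by (simp_all add: O1_def O2_def O3_def)

lemma vertices_distinct: "O1 \<noteq> O2" "O1 \<noteq> O3" "O2 \<noteq> O3"
proof -
  have "O1$1 \<noteq> O2$1" "O1$1 \<noteq> O3$1" "O2$1 \<noteq> O3$1" by (simp_all add: vertex_coords)
  then show "O1 \<noteq> O2" "O1 \<noteq> O3" "O2 \<noteq> O3" by metis+
qed

lemma barycentric_vertex:
  assumes "c \<in> gasket_vertices" "d \<in> gasket_vertices"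
  shows "barycentric c d = (if c = d then 1 else 0)"
  using assms vertices_distinct
  by (auto simp: gasket_vertices_def barycentric_def vertex_coords)

text \<open>The contracted point is the midpoint of \<open>y\<close> and \<open>c\<close>, and
  barycentric coordinates are affine.\<close>

lemma barycentric_half_contraction:
  "barycentric d (half_contraction c y) = (barycentric d y + barycentric d c) / 2"
proof -
  have "half_contraction c y $ i = y$i / 2 + c$i / 2" for i
    by (simp add: half_contraction_def diff_divide_distrib)
  then show ?thesis
    by (simp add: barycentric_def add_divide_distrib diff_divide_distrib)
qed

lemma gasket_vertices_subset_triangle: "gasket_vertices \<subseteq> gasket_triangle"
  by (auto simp: gasket_triangle_def barycentric_vertex)

lemma half_contraction_triangle:
  assumes "c \<in> gasket_triangle" "y \<in> gasket_triangle"
  shows "half_contraction c y \<in> gasket_triangle"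
  using assms by (simp add: gasket_triangle_def barycentric_half_contraction)

lemma gasket_step_triangle: "gasket_step gasket_triangle \<subseteq> gasket_triangle"
  unfolding gasket_step_eq
  using gasket_vertices_subset_triangle half_contraction_triangle by blast

lemma closed_gasket_triangle: "closed gasket_triangle"
proof -
  have "continuous_on UNIV (barycentric c)" for c
    unfolding barycentric_def by (cases "c = O1"; cases "c = O2") (auto intro!: continuous_intros)
  then have "closed {y. 0 \<le> barycentric c y}" for c
    by (intro closed_Collect_le continuous_intros)
  then have "closed (\<Inter>c\<in>gasket_vertices. {y. 0 \<le> barycentric c y})" by blast
  moreover have "gasket_triangle = (\<Inter>c\<in>gasket_vertices. {y. 0 \<le> barycentric c y})"
    by (auto simp: gasket_triangle_def)
  ultimately show ?thesis by simp
qed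

text \<open>The three coordinates are nonnegative and add up to 1, so the other two vanish.\<close>

lemma eq_vertex_if_barycentric_ge_1:
  assumes "y \<in> gasket_triangle" "d \<in> gasket_vertices" "barycentric d y \<ge> 1"
  shows "y = d"
proof -
  \<comment> \<open>This rescaling hides the factor \<open>sqrt 3\<close>, which leaves only linear
    arithmetic.\<close>
  define h where "h = y$2 / sqrt 3"
  have y2: "y$2 = sqrt 3 * h" by (simp add: h_def)
  have b: "barycentric O1 y = 1/2 - y$1 - h" "barycentric O2 y = 1/2 + y$1 - h"
    "barycentric O3 y = 2 * h"
    using vertices_distinct by (simp_all add: barycentric_def h_def)
  have T: "0 \<le> 1/2 - y$1 - h" "0 \<le> 1/2 + y$1 - h" "0 \<le> 2 * h"
    using assms(1) unfolding gasket_triangle_def b[symmetric] by (simp_all add: gasket_vertices_def)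
  consider "d = O1" | "d = O2" | "d = O3"
    using assms(2) unfolding gasket_vertices_def by blast
  then show ?thesis
  proof cases
    case 1
    then have "h = 0" "y$1 = -1/2" using T assms(3) b by simp_all
    then show ?thesis using y2 by (simp add: 1 vec_eq_iff forall_2 vertex_coords)
  next
    case 2
    then have "h = 0" "y$1 = 1/2" using T assms(3) b by simp_all
    then show ?thesis using y2 by (simp add: 2 vec_eq_iff forall_2 vertex_coords)
  next
    case 3
    then have "h = 1/2" "y$1 = 0" using T assms(3) b by simp_all
    then show ?thesis using y2 by (simp add: 3 vec_eq_iff forall_2 vertex_coords)
  qed
qed

text \<open>Corners are extreme points: the midpoint of \<open>y\<close> and \<open>c\<close> has
  \<open>d\<close>-coordinate 1 while that of \<open>c\<close> is at most 1, so that of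
  \<open>y\<close> is at least 1.\<close>

lemma half_contraction_eq_vertex:
  assumes "c \<in> gasket_vertices" "d \<in> gasket_vertices" "y \<in> gasket_triangle"
    and eq: "half_contraction c y = d"
  shows "y = d"
proof (rule eq_vertex_if_barycentric_ge_1)
  have "(barycentric d y + barycentric d c) / 2 = 1"
    using barycentric_half_contraction[of d c y] barycentric_vertex[of d d] assms by simp
  then show "barycentric d y \<ge> 1"
    using barycentric_vertex[of d c] assms by (simp split: if_splits)
qed (use assms in auto)

text \<open>Two different level-one cells touch in a single point. In the
  \<open>d\<close>-coordinate the centre \<open>c\<close> contributes 0 and the centre
  \<open>d\<close> contributes 1, so the coordinate of \<open>y\<close> exceeds the nonnegative one
  of \<open>z\<close> by 1.\<close>

lemma half_contraction_eq_half_contraction: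
  assumes "c \<in> gasket_vertices" "d \<in> gasket_vertices" "c \<noteq> d"
    and "y \<in> gasket_triangle" "z \<in> gasket_triangle"
    and eq: "half_contraction c y = half_contraction d z"
  shows "y = d"
proof (rule eq_vertex_if_barycentric_ge_1)
  have "barycentric d y + barycentric d c = barycentric d z + barycentric d d"
    using barycentric_half_contraction[of d c y] barycentric_half_contraction[of d d z] eq by simp
  then show "barycentric d y \<ge> 1"
    using assms by (simp add: barycentric_vertex gasket_triangle_def)
qed (use assms in auto)

section \<open>Cells of level n and their common points\<close>

lemma cell_maps_SucE:
  assumes "\<phi> \<in> cell_maps (Suc n)"
  obtains c \<psi> where "c \<in> gasket_vertices" "\<psi> \<in> cell_maps n" "\<phi> = half_contraction c \<circ> \<psi>"
  using assms unfolding cell_maps.simps by (elim UN_E imageE)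

lemma cell_maps_triangle:
  "\<phi> \<in> cell_maps n \<Longrightarrow> y \<in> gasket_triangle \<Longrightarrow> \<phi> y \<in> gasket_triangle"
proof (induction n arbitrary: \<phi>)
  case (Suc n)
  obtain c \<psi> where c: "c \<in> gasket_vertices" "\<psi> \<in> cell_maps n" "\<phi> = half_contraction c \<circ> \<psi>"
    using Suc.prems(1) by (rule cell_maps_SucE)
  have "c \<in> gasket_triangle" using c(1) gasket_vertices_subset_triangle by blast
  then show ?case
    unfolding c(3) o_apply by (rule half_contraction_triangle) (rule Suc.IH[OF c(2) Suc.prems(2)])
qed simp

text \<open>Peeling off the outermost contraction leaves a corner of the big triangle where it is,
  so the induction hypothesis applies to the same \<open>c\<close>.\<close>

lemma vertex_in_cell:
  assumes "\<phi> \<in> cell_maps n" "c \<in> gasket_vertices" "c \<in> \<phi> ` gasket_triangle"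
  shows "c \<in> \<phi> ` gasket_vertices"
  using assms
proof (induction n arbitrary: \<phi>)
  case (Suc n)
  obtain d \<psi> where d: "d \<in> gasket_vertices" "\<psi> \<in> cell_maps n" "\<phi> = half_contraction d \<circ> \<psi>"
    using Suc.prems(1) by (rule cell_maps_SucE)
  obtain y where y: "y \<in> gasket_triangle" "c = half_contraction d (\<psi> y)"
    using Suc.prems(3) unfolding d(3) image_comp[symmetric] by (elim imageE) simp
  have \<psi>y: "\<psi> y = c"
    by (rule half_contraction_eq_vertex[OF d(1) Suc.prems(2) cell_maps_triangle[OF d(2) y(1)] y(2)[symmetric]])
  then have "c \<in> \<psi> ` gasket_triangle" using y(1) by (metis imageI)
  then have "c \<in> \<psi> ` gasket_vertices" by (rule Suc.IH[OF d(2) Suc.prems(2)])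
  moreover have "c = half_contraction d c" using y(2) unfolding \<psi>y .
  ultimately show ?case unfolding d(3) image_comp[symmetric] by (metis imageI)
qed simp

text \<open>If the outermost contractions agree, injectivity cancels them and induction applies. If
  they differ, the inner point is a corner of the big triangle, and a smaller cell can contain such
  a point only as one of its own corners.\<close>

lemma cell_Int_cell:
  assumes "\<phi> \<in> cell_maps n" "\<psi> \<in> cell_maps n" "\<phi> \<noteq> \<psi>"
    and "x \<in> \<phi> ` gasket_triangle" "x \<in> \<psi> ` gasket_triangle"
  shows "x \<in> \<phi> ` gasket_vertices"
  using assms
proof (induction n arbitrary: \<phi> \<psi> x)
  case (Suc n)
  obtain c \<phi>' where c: "c \<in> gasket_vertices" "\<phi>' \<in> cell_maps n" "\<phi> = half_contraction c \<circ> \<phi>'"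
    using Suc.prems(1) by (rule cell_maps_SucE)
  obtain d \<psi>' where d: "d \<in> gasket_vertices" "\<psi>' \<in> cell_maps n" "\<psi> = half_contraction d \<circ> \<psi>'"
    using Suc.prems(2) by (rule cell_maps_SucE)
  obtain y where y: "y \<in> gasket_triangle" "x = half_contraction c (\<phi>' y)"
    using Suc.prems(4) c(3) by auto
  obtain z where z: "z \<in> gasket_triangle" "x = half_contraction d (\<psi>' z)"
    using Suc.prems(5) d(3) by auto
  have eq: "half_contraction c (\<phi>' y) = half_contraction d (\<psi>' z)"
    using y(2) z(2) by (rule subst)
  have "\<phi>' y \<in> \<phi>' ` gasket_vertices"
  proof (cases "c = d")
    case True
    have "\<phi>' y = \<psi>' z"
      using injD[OF inj_half_contraction eq[folded True]] .
    then have "\<phi>' y \<in> \<psi>' ` gasket_triangle" using z(1) by simp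
    moreover have "\<phi>' \<noteq> \<psi>'" using Suc.prems(3) c(3) d(3) True by blast
    ultimately show ?thesis using Suc.IH[OF c(2) d(2)] y(1) by blast
  next
    case False
    have "\<phi>' y = d"
      using half_contraction_eq_half_contraction[OF c(1) d(1) False _ _ eq]
        cell_maps_triangle[OF c(2) y(1)] cell_maps_triangle[OF d(2) z(1)] by simp
    then show ?thesis using vertex_in_cell[OF c(2) d(1)] y(1) by blast
  qed
  then show ?case unfolding y(2) c(3) image_comp[symmetric] by (rule imageI)
qed auto

lemma cell_maps_affine:
  "\<phi> \<in> cell_maps n \<Longrightarrow> \<exists>v. \<phi> = (\<lambda>x. (1/2)^n *\<^sub>R x + v)"
proof (induction n arbitrary: \<phi>)
  case 0
  then show ?case by (auto intro!: exI[of _ 0])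
next
  case (Suc n)
  then obtain c \<psi> where c: "\<psi> \<in> cell_maps n" "\<phi> = half_contraction c \<circ> \<psi>"
    using cell_maps_SucE by metis
  obtain v where "\<psi> = (\<lambda>x. (1/2)^n *\<^sub>R x + v)" using Suc.IH c by blast
  then show ?case
    by (intro exI[of _ "(1/2) *\<^sub>R v + (1/2) *\<^sub>R c"])
      (auto simp: c half_contraction_def fun_eq_iff vec_eq_iff algebra_simps)
qed

lemma dist_cell_map: "\<phi> \<in> cell_maps n \<Longrightarrow> dist (\<phi> x) (\<phi> y) = dist x y / 2 ^ n"
  using cell_maps_affine[of \<phi> n] by (auto simp: dist_norm power_divide simp flip: scaleR_diff_right)

lemma cell_map_closed_segment:
  assumes "\<phi> \<in> cell_maps n"
  shows "closed_segment (\<phi> x) (\<phi> y) = \<phi> ` closed_segment x y"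
proof -
  obtain v where v: "\<phi> = (\<lambda>x. (1/2)^n *\<^sub>R x + v)" using cell_maps_affine[OF assms] by blast
  have "linear (\<lambda>x::real^2. (1/2::real)^n *\<^sub>R x)" by (simp add: linear_scaleR)
  from closed_segment_linear_image[OF this, of x y] show ?thesis
    using closed_segment_translation[of v "(1/2)^n *\<^sub>R x" "(1/2)^n *\<^sub>R y"]
    by (simp add: v image_image add.commute)
qed

lemma continuous_on_cell_map: "\<phi> \<in> cell_maps n \<Longrightarrow> continuous_on S \<phi>"
  using cell_maps_affine[of \<phi> n] by (auto intro!: continuous_intros)

lemma finite_cell_maps: "finite (cell_maps n)"
  by (induction n) (auto simp: gasket_vertices_def)

lemma gasket_step_funpow: "(gasket_step ^^ n) S = (\<Union>\<phi>\<in>cell_maps n. \<phi> ` S)"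
  by (induction n) (auto simp: gasket_step_eq image_Union image_comp)

lemma gasket_network_cells: "gasket_network n = (\<Union>\<phi>\<in>cell_maps n. \<phi> ` gasket_network 0)"
proof -
  have "gasket_network n = (gasket_step ^^ n) (gasket_network 0)" by (induction n) auto
  then show ?thesis by (simp only: gasket_step_funpow)
qed

section \<open>The gasket and its networks as unions over cells\<close>

lemma gasket_nonempty: "sierpinski_gasket \<noteq> {}"
  and compact_gasket: "compact sierpinski_gasket"
  and gasket_step_gasket: "gasket_step sierpinski_gasket = sierpinski_gasket"
  using theI'[OF sierpinski_gasket_unique_existence]
  unfolding sierpinski_gasket_def by auto

lemma gasket_cells: "sierpinski_gasket = (\<Union>\<phi>\<in>cell_maps n. \<phi> ` sierpinski_gasket)"
proof -
  have "(gasket_step ^^ n) sierpinski_gasket = sierpinski_gasket"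
    by (induction n) (auto simp: gasket_step_gasket)
  then show ?thesis by (simp add: gasket_step_funpow)
qed

text \<open>A point of \<open>A\<close> farthest from \<open>B\<close> is the image of some point of \<open>A\<close> under a contraction by
  \<open>1/2\<close> that maps \<open>B\<close> into itself, so its distance from \<open>B\<close> is at most half of itself.\<close>

lemma sub_fixed_subset_super_fixed:
  assumes A: "compact A" "A \<subseteq> gasket_step A"
    and B: "closed B" "B \<noteq> {}" "gasket_step B \<subseteq> B"
  shows "A \<subseteq> B"
proof (cases "A = {}")
  case False
  have "continuous_on A (\<lambda>x. infdist x B)" by (intro continuous_intros)
  then obtain x where x: "x \<in> A" "\<And>y. y \<in> A \<Longrightarrow> infdist y B \<le> infdist x B"
    using continuous_attains_sup[OF A(1) False] by blast
  obtain c z where cz: "c \<in> gasket_vertices" "z \<in> A" "x = half_contraction c z"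
    using x A(2) unfolding gasket_step_eq by blast
  obtain b where b: "b \<in> B" "infdist z B = dist z b"
    using infdist_attains_inf[OF B(1,2)] by metis
  have "half_contraction c b \<in> B" using B(3) b cz unfolding gasket_step_eq by blast
  then have "infdist x B \<le> dist x (half_contraction c b)" by (rule infdist_le)
  also have "\<dots> = infdist z B / 2" by (simp add: cz b dist_half_contraction)
  also have "\<dots> \<le> infdist x B / 2" using x cz by simp
  finally have "infdist x B \<le> 0" by simp
  then have "infdist y B = 0" if "y \<in> A" for y
    using x(2)[OF that] infdist_nonneg[of y B] by linarith
  then show ?thesis using in_closed_iff_infdist_zero[OF B(1,2)] by blast
qed simp

lemma gasket_subset_triangle: "sierpinski_gasket \<subseteq> gasket_triangle"
proof (rule sub_fixed_subset_super_fixed)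
  show "gasket_triangle \<noteq> {}"
    using gasket_vertices_subset_triangle by (auto simp: gasket_vertices_def)
qed (simp_all add: compact_gasket gasket_step_gasket closed_gasket_triangle gasket_step_triangle)

lemma closed_segment_vertices:
  assumes "c \<in> gasket_vertices" "d \<in> gasket_vertices"
  shows "closed_segment c d \<subseteq> gasket_network 0"
  using assms by (auto simp: gasket_vertices_def closed_segment_commute)

text \<open>Each half of the segment is the image of the whole under the contraction towards the end
  it contains. Hence segments between corners are sub-fixed sets, which places the sides of the
  triangle inside the gasket.\<close>

lemma closed_segment_subset_gasket_step:
  assumes "c \<in> gasket_vertices" "d \<in> gasket_vertices"
  shows "closed_segment c d \<subseteq> gasket_step (closed_segment c d)"
proof
  fix x assume "x \<in> closed_segment c d"
  then obtain u where u: "0 \<le> u" "u \<le> 1" "x = (1 - u) *\<^sub>R c + u *\<^sub>R d"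
    by (auto simp: closed_segment_def)
  show "x \<in> gasket_step (closed_segment c d)"
  proof (cases "u \<le> 1/2")
    case True
    have "x = half_contraction c ((1 - 2 * u) *\<^sub>R c + (2 * u) *\<^sub>R d)"
      by (simp add: u half_contraction_def vec_eq_iff algebra_simps)
    moreover have "(1 - 2 * u) *\<^sub>R c + (2 * u) *\<^sub>R d \<in> closed_segment c d"
      using True u by (auto simp: closed_segment_def intro!: exI[of _ "2 * u"])
    ultimately show ?thesis using assms unfolding gasket_step_eq by blast
  next
    case False
    have "x = half_contraction d ((1 - (2 * u - 1)) *\<^sub>R c + (2 * u - 1) *\<^sub>R d)"
      by (simp add: u half_contraction_def vec_eq_iff algebra_simps)
    moreover have "(1 - (2 * u - 1)) *\<^sub>R c + (2 * u - 1) *\<^sub>R d \<in> closed_segment c d"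
      using False u by (subst closed_segment_def) (intro CollectI exI[of _ "2 * u - 1"], auto)
    ultimately show ?thesis using assms unfolding gasket_step_eq by blast
  qed
qed

lemma gasket_network_subset_gasket: "gasket_network n \<subseteq> sierpinski_gasket"
proof (induction n)
  case 0
  have "closed_segment c d \<subseteq> sierpinski_gasket"
    if "c \<in> gasket_vertices" "d \<in> gasket_vertices" for c d
    by (rule sub_fixed_subset_super_fixed[OF _ closed_segment_subset_gasket_step[OF that]])
      (simp_all add: gasket_nonempty compact_gasket compact_imp_closed gasket_step_gasket)
  then show ?case by (simp add: gasket_vertices_def)
next
  case (Suc n)
  then show ?case using gasket_step_mono[OF Suc] by (simp add: gasket_step_gasket)
qed

lemma intrinsic_dist_cell_segment:
  assumes "\<phi> \<in> cell_maps n" "closed_segment x y \<subseteq> gasket_network 0"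
  shows "intrinsic_dist (gasket_network n) (\<phi> x) (\<phi> y) \<le> ennreal (dist (\<phi> x) (\<phi> y))"
proof (rule intrinsic_dist_closed_segment)
  show "closed_segment (\<phi> x) (\<phi> y) \<subseteq> gasket_network n"
    unfolding cell_map_closed_segment[OF assms(1)] gasket_network_cells[of n]
    using assms by blast
qed

section \<open>Comparing the two distances\<close>

text \<open>The perimeter of the triangle serves as a common bound for the distance between any two
  corners, without computing side lengths.\<close>

definition vertex_diam :: real where
  "vertex_diam = dist O1 O2 + dist O2 O3 + dist O3 O1"

text \<open>The point lies on a side of some cell, and the part of this side from the point to a
  corner belongs to the network. Membership in the image of the gasket is recorded so that the pair
  can be used in \<open>cell_extension\<close>.\<close>

lemma network_vertex_near:
  assumes "x \<in> gasket_network n"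
  obtains \<phi> c where "\<phi> \<in> cell_maps n" "c \<in> gasket_vertices" "x \<in> \<phi> ` sierpinski_gasket"
    "dist x (\<phi> c) \<le> vertex_diam / 2 ^ n"
    "intrinsic_dist (gasket_network n) x (\<phi> c) \<le> ennreal (vertex_diam / 2 ^ n)"
proof -
  obtain \<phi> z where z: "\<phi> \<in> cell_maps n" "z \<in> gasket_network 0" "x = \<phi> z"
    using assms unfolding gasket_network_cells[of n] by blast
  obtain c d where cd: "c \<in> gasket_vertices" "d \<in> gasket_vertices" "z \<in> closed_segment c d"
    using z(2) by (auto simp: gasket_vertices_def)
  have "dist z c \<le> dist c d" using cd(3) dist_in_closed_segment by blast
  also have "\<dots> \<le> vertex_diam"
    using cd(1,2) by (auto simp: vertex_diam_def gasket_vertices_def dist_commute)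
  finally have d: "dist x (\<phi> c) \<le> vertex_diam / 2 ^ n"
    by (simp add: z(3) dist_cell_map[OF z(1)] divide_right_mono)
  have "closed_segment z c \<subseteq> closed_segment c d"
    using cd(3) by (simp add: subset_closed_segment)
  then have "closed_segment z c \<subseteq> gasket_network 0"
    using closed_segment_vertices[OF cd(1,2)] by blast
  then have "intrinsic_dist (gasket_network n) x (\<phi> c) \<le> ennreal (vertex_diam / 2 ^ n)"
    using order_trans[OF intrinsic_dist_cell_segment[OF z(1)] ennreal_leI[OF d[unfolded z(3)]]]
    by (simp add: z(3))
  then show ?thesis
    using that[OF z(1) cd(1) _ d] z gasket_network_subset_gasket[of 0] by blast
qed

text \<open>\<open>cell_extension n p\<close> extends the network distance from \<open>p\<close>, restricted to the vertices of
  the level-\<open>n\<close> cells, to a function that is 1-Lipschitz on each cell for the Euclidean distance.\<close>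

definition cell_extension :: "nat \<Rightarrow> real^2 \<Rightarrow> real^2 \<Rightarrow> ennreal" where
  "cell_extension n p y =
     (INF (\<phi>, c) \<in> {(\<phi>, c). \<phi> \<in> cell_maps n \<and> c \<in> gasket_vertices \<and> y \<in> \<phi> ` sierpinski_gasket}.
        intrinsic_dist (gasket_network n) p (\<phi> c) + ennreal (dist y (\<phi> c)))"

lemma cell_extension_le:
  assumes "\<phi> \<in> cell_maps n" "c \<in> gasket_vertices" "y \<in> \<phi> ` sierpinski_gasket"
  shows "cell_extension n p y
    \<le> intrinsic_dist (gasket_network n) p (\<phi> c) + ennreal (dist y (\<phi> c))"
  unfolding cell_extension_def by (rule INF_lower2[of "(\<phi>, c)"]) (use assms in auto)

text \<open>The straight segment between two corners of a cell is contained in the network, so it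
  costs only its Euclidean length.\<close>

lemma intrinsic_dist_same_cell:
  assumes "\<phi> \<in> cell_maps n" "c \<in> gasket_vertices" "d \<in> gasket_vertices"
  shows "intrinsic_dist (gasket_network n) p (\<phi> c)
    \<le> intrinsic_dist (gasket_network n) p (\<phi> d) + ennreal (dist (\<phi> c) (\<phi> d))"
  using order_trans[OF intrinsic_dist_triangle add_left_mono[OF
      intrinsic_dist_cell_segment[OF assms(1) closed_segment_vertices[OF assms(3,2)]]]]
  by (simp add: dist_commute)

lemma in_distinct_cells_vertex:
  assumes "\<phi> \<in> cell_maps n" "\<psi> \<in> cell_maps n" "\<phi> \<noteq> \<psi>"
    and "y \<in> \<phi> ` sierpinski_gasket" "y \<in> \<psi> ` sierpinski_gasket"
  shows "y \<in> \<phi> ` gasket_vertices"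
  using cell_Int_cell[OF assms(1-3)] assms(4,5) gasket_subset_triangle by blast

text \<open>The infimum at \<open>y\<close> also ranges over cells other than the given one. In that
  case \<open>y\<close> is a corner of both cells; reaching it along the network through the other
  cell costs no more than the Euclidean term, and from there \<open>x\<close> is reached inside the
  given cell.\<close>

lemma cell_extension_lipschitz:
  assumes \<phi>: "\<phi> \<in> cell_maps n" and x: "x \<in> \<phi> ` sierpinski_gasket" and y: "y \<in> \<phi> ` sierpinski_gasket"
  shows "cell_extension n p x \<le> cell_extension n p y + ennreal (dist x y)"
  unfolding cell_extension_def[of n p y]
proof (rule le_INF_add_ennreal, clarify del: imageE)
  fix \<psi> d assume \<psi>: "\<psi> \<in> cell_maps n" and d: "d \<in> gasket_vertices" and y': "y \<in> \<psi> ` sierpinski_gasket"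
  let ?D = "intrinsic_dist (gasket_network n) p"
  show "cell_extension n p x \<le> ?D (\<psi> d) + ennreal (dist y (\<psi> d)) + ennreal (dist x y)"
  proof (cases "\<phi> = \<psi>")
    case True
    have "cell_extension n p x \<le> ?D (\<psi> d) + ennreal (dist x (\<psi> d))"
      using cell_extension_le[OF \<phi> d x] True by simp
    also have "ennreal (dist x (\<psi> d)) \<le> ennreal (dist y (\<psi> d)) + ennreal (dist x y)"
      using dist_triangle[of x "\<psi> d" y] by (simp add: ennreal_leI add.commute flip: ennreal_plus)
    finally show ?thesis by (simp add: add.assoc add_left_mono)
  next
    case False
    obtain c where c: "c \<in> gasket_vertices" "y = \<phi> c"
      using in_distinct_cells_vertex[OF \<phi> \<psi> False y y'] by (elim imageE)
    obtain e where e: "e \<in> gasket_vertices" "y = \<psi> e"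
      using in_distinct_cells_vertex[OF \<psi> \<phi> False[symmetric] y' y] by (elim imageE)
    have "cell_extension n p x \<le> ?D y + ennreal (dist x y)"
      using cell_extension_le[OF \<phi> c(1) x] c by simp
    also have "?D y \<le> ?D (\<psi> d) + ennreal (dist y (\<psi> d))"
      using intrinsic_dist_same_cell[OF \<psi> e(1) d] e by simp
    finally show ?thesis by (simp add: add_right_mono)
  qed
qed

text \<open>Every cell that contains this vertex has it as a corner, so passing through another
  corner of such a cell cannot undercut the network distance.\<close>

lemma cell_extension_vertex:
  assumes \<phi>: "\<phi> \<in> cell_maps n" and c: "c \<in> gasket_vertices"
  shows "intrinsic_dist (gasket_network n) p (\<phi> c) \<le> cell_extension n p (\<phi> c)"
  unfolding cell_extension_def
proof (rule INF_greatest, clarify del: imageE)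
  fix \<psi> d z assume \<psi>: "\<psi> \<in> cell_maps n" and d: "d \<in> gasket_vertices"
    and \<psi>c: "\<phi> c \<in> \<psi> ` sierpinski_gasket"
  have "c \<in> sierpinski_gasket"
    using c gasket_network_subset_gasket[of 0] by (auto simp: gasket_vertices_def)
  then have \<phi>c: "\<phi> c \<in> \<phi> ` sierpinski_gasket" by (rule imageI)
  have "\<phi> c \<in> \<psi> ` gasket_vertices"
  proof (cases "\<psi> = \<phi>")
    case False
    show ?thesis by (rule in_distinct_cells_vertex[OF \<psi> \<phi> False \<psi>c \<phi>c])
  qed (use c in simp)
  then obtain e where e: "\<phi> c = \<psi> e" "e \<in> gasket_vertices" by (elim imageE)
  show "intrinsic_dist (gasket_network n) p (\<phi> c)
      \<le> intrinsic_dist (gasket_network n) p (\<psi> d) + ennreal (dist (\<phi> c) (\<psi> d))"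
    unfolding e(1) by (rule intrinsic_dist_same_cell[OF \<psi> e(2) d])
qed

text \<open>For each curve the gasket is covered by its finitely many compact level-n cells, on
  which the extension is 1-Lipschitz; then the infimum over curves is taken.\<close>

lemma cell_extension_le_intrinsic_dist:
  "cell_extension n p y \<le> intrinsic_dist sierpinski_gasket x y + cell_extension n p x"
  unfolding intrinsic_dist_def
proof (rule le_INF_add_ennreal, clarify)
  fix g assume g: "path g" "path_image g \<subseteq> sierpinski_gasket" "x = pathstart g" "y = pathfinish g"
  have "cell_extension n p (pathfinish g) \<le> cell_extension n p (pathstart g) + curve_length g"
  proof (rule lipschitz_on_pieces_le_curve_length)
    let ?A = "(\<lambda>\<phi>. \<phi> ` sierpinski_gasket) ` cell_maps n"
    show "finite ?A" by (simp add: finite_cell_maps)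
    show "closed A" if "A \<in> ?A" for A
      using that compact_continuous_image[OF continuous_on_cell_map compact_gasket]
      by (auto intro: compact_imp_closed)
    show "path_image g \<subseteq> \<Union>?A" using g(2) gasket_cells[of n] by simp
    show "cell_extension n p v \<le> cell_extension n p u + ennreal (dist u v)"
      if "A \<in> ?A" "u \<in> A" "v \<in> A" for A u v
      using that by (elim imageE, subst dist_commute) (rule cell_extension_lipschitz, simp_all)
  qed (use g in auto)
  then show "cell_extension n p (pathfinish g)
      \<le> curve_length g + cell_extension n p (pathstart g)" by (simp add: add.commute)
qed

text \<open>The constant 4 counts cell-size errors: two for the value of the extension at
  \<open>x\<close>, one for moving from \<open>y\<close> to a nearby vertex in the extension, and
  one for returning from that vertex to \<open>y\<close> in the network.\<close>

lemma network_dist_le_gasket_dist: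
  assumes "x \<in> gasket_network n" "y \<in> gasket_network n"
  shows "intrinsic_dist (gasket_network n) x y
    \<le> intrinsic_dist sierpinski_gasket x y + ennreal (4 * vertex_diam / 2 ^ n)"
proof -
  let ?e = "vertex_diam / 2 ^ n"
  let ?D = "intrinsic_dist (gasket_network n)"
  have e: "?e \<ge> 0" by (simp add: vertex_diam_def)
  obtain \<phi> c where c: "\<phi> \<in> cell_maps n" "c \<in> gasket_vertices" "x \<in> \<phi> ` sierpinski_gasket"
    "dist x (\<phi> c) \<le> ?e" "?D x (\<phi> c) \<le> ennreal ?e"
    using network_vertex_near[OF assms(1)] .
  obtain \<psi> d where d: "\<psi> \<in> cell_maps n" "d \<in> gasket_vertices" "y \<in> \<psi> ` sierpinski_gasket"
    "dist y (\<psi> d) \<le> ?e" "?D y (\<psi> d) \<le> ennreal ?e"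
    using network_vertex_near[OF assms(2)] .
  have d': "\<psi> d \<in> \<psi> ` sierpinski_gasket"
    using d gasket_network_subset_gasket[of 0] by (auto simp: gasket_vertices_def)
  \<comment> \<open>Although \<open>x\<close> is also the base point, this value need not vanish
    when \<open>x\<close> is not a vertex: it counts going to a vertex along the network and coming
    back straight.\<close>
  have "cell_extension n x x \<le> ennreal ?e + ennreal ?e"
    using order_trans[OF cell_extension_le[OF c(1-3)] add_mono[OF c(5) ennreal_leI[OF c(4)]]] .
  then have "cell_extension n x y \<le> intrinsic_dist sierpinski_gasket x y + (ennreal ?e + ennreal ?e)"
    using order_trans[OF cell_extension_le_intrinsic_dist add_left_mono] by blast
  then have y: "cell_extension n x y + ennreal ?e
      \<le> intrinsic_dist sierpinski_gasket x y + (ennreal ?e + ennreal ?e) + ennreal ?e"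
    by (rule add_right_mono)
  have "cell_extension n x (\<psi> d) \<le> cell_extension n x y + ennreal ?e"
    using order_trans[OF cell_extension_lipschitz[OF d(1) d' d(3)] add_left_mono[OF ennreal_leI]] d(4)
    by (simp add: dist_commute)
  then have v: "cell_extension n x (\<psi> d) + ennreal ?e
      \<le> intrinsic_dist sierpinski_gasket x y + (ennreal ?e + ennreal ?e) + ennreal ?e + ennreal ?e"
    by (intro add_right_mono) (rule order_trans[OF _ y])
  have "?D x y \<le> cell_extension n x (\<psi> d) + ennreal ?e"
    using cell_extension_vertex[OF d(1,2), of x] d(5)
    by (intro order_trans[OF intrinsic_dist_triangle[of _ x y "\<psi> d"]] add_mono)
      (simp_all add: intrinsic_dist_commute[of _ "\<psi> d"])
  also note v
  also have "intrinsic_dist sierpinski_gasket x y + (ennreal ?e + ennreal ?e) + ennreal ?e + ennreal ?e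
      = intrinsic_dist sierpinski_gasket x y + ennreal (4 * ?e)"
    using e by (simp add: add.assoc flip: ennreal_plus)
  finally show ?thesis by simp
qed

theorem theorem4p4:
  fixes a b :: "real^2" and as bs :: "nat \<Rightarrow> real^2"
  assumes "a \<in> sierpinski_gasket" and "b \<in> sierpinski_gasket"
    and "\<And>n. as n \<in> gasket_network n" and "\<And>n. bs n \<in> gasket_network n"
    and "(\<lambda>n. intrinsic_dist sierpinski_gasket (as n) a) \<longlonglongrightarrow> 0"
    and "(\<lambda>n. intrinsic_dist sierpinski_gasket (bs n) b) \<longlonglongrightarrow> 0"
  shows "(\<lambda>n. intrinsic_dist (gasket_network n) (as n) (bs n))
           \<longlonglongrightarrow> intrinsic_dist sierpinski_gasket a b"
proof -
  let ?K = "sierpinski_gasket"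
  let ?d = "intrinsic_dist ?K"
  let ?e = "\<lambda>n. ?d (as n) a + ?d (bs n) b"
  let ?f = "\<lambda>n. intrinsic_dist (gasket_network n) (as n) (bs n)"
  let ?r = "\<lambda>n. ennreal (4 * vertex_diam / 2 ^ n)"
  have e0: "?e \<longlonglongrightarrow> 0"
    using tendsto_add[OF assms(5,6)] by simp
  have r0: "?r \<longlonglongrightarrow> 0"
    using tendsto_ennrealI[OF LIMSEQ_divide_realpow_zero[of 2 "4 * vertex_diam"]] by simp
  \<comment> \<open>Stated as a sum, since subtraction in \<open>ennreal\<close> has to wait until
    the error is known to be finite.\<close>
  have low: "?d a b \<le> ?e n + ?f n" for n
  proof -
    have "?d a b \<le> ?d a (as n) + (?d (as n) (bs n) + ?d (bs n) b)"
      by (rule order_trans[OF intrinsic_dist_triangle add_left_mono[OF intrinsic_dist_triangle]])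
    also have "?d (as n) (bs n) \<le> ?f n"
      by (rule intrinsic_dist_mono[OF gasket_network_subset_gasket])
    finally show ?thesis
      by (simp add: intrinsic_dist_commute[of ?K a] ac_simps add_left_mono add_right_mono)
  qed
  have up: "?f n \<le> ?d a b + (?e n + ?r n)" for n
  proof -
    have "?d (as n) (bs n) \<le> ?d (as n) a + (?d a b + ?d b (bs n))"
      by (rule order_trans[OF intrinsic_dist_triangle add_left_mono[OF intrinsic_dist_triangle]])
    then have "?d (as n) (bs n) \<le> ?d a b + ?e n"
      by (simp add: intrinsic_dist_commute[of ?K b] ac_simps)
    from order_trans[OF network_dist_le_gasket_dist[OF assms(3,4)] add_right_mono[OF this]]
    show ?thesis by (simp add: add.assoc)
  qed
  show ?thesis
  proof (rule tendsto_sandwich)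
    have "(\<lambda>n. ?d a b - ?e n) \<longlonglongrightarrow> ?d a b - 0"
      by (rule tendsto_diff_ennreal_general[OF tendsto_const e0]) simp
    then show "(\<lambda>n. ?d a b - ?e n) \<longlonglongrightarrow> ?d a b" by simp
    have "(\<lambda>n. ?d a b + (?e n + ?r n)) \<longlonglongrightarrow> ?d a b + (0 + 0)"
      by (intro tendsto_add tendsto_const e0 r0)
    then show "(\<lambda>n. ?d a b + (?e n + ?r n)) \<longlonglongrightarrow> ?d a b" by simp
    \<comment> \<open>A difference of two infinite values is infinite in \<open>ennreal\<close>, so
      \<open>low\<close> gives a bound for the difference where \<open>?e n\<close> is finite, which
      holds eventually.\<close>
    have "\<forall>\<^sub>F n in sequentially. ?e n \<noteq> top"
      using order_tendstoD(2)[OF e0, of top] by (rule eventually_mono) auto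
    then show "\<forall>\<^sub>F n in sequentially. ?d a b - ?e n \<le> ?f n"
      by eventually_elim (use low in \<open>auto simp: ennreal_minus_le_iff\<close>)
    show "\<forall>\<^sub>F n in sequentially. ?f n \<le> ?d a b + (?e n + ?r n)"
      using up by simp
  qed
qed

end
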